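(* There exist irrational numbers $\alpha$ such that $\mathcal F_\alpha\notin C^0(\mathbb T_1)$, i.e. $\mathcal F_\alpha$ has no continuous representative. More strongly, for such $\alpha$, the Abel means $$\sum_{n\ge1}\frac{e^{2\pi i\alpha n^2}}{n}r^n,\qquad 0<r<1,$$ are unbounded as $r\uparrow1$. (That is, there exist irrational $\alpha$ for which these Abel means are unbounded as $r\uparrow1$ and $\mathcal F_\alpha\notin C^0(\mathbb T_1)$.)
   Context: $\mathbb T_1=\mathbb R/\mathbb Z$. For $\alpha\in\mathbb R$, the one-sided quadratic logarithmic series is $\mathcal F_\alpha(\beta)=\sum_{n\ge1}\frac{e^{2\pi i(\alpha n^2+\beta n)}}{n}$, with $\beta$ regarded modulo $1$; the series defines an element of $L^2(\mathbb T_1)$. *)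

theory Defs
  imports "HOL-Analysis.Analysis"
begin

text \<open>
  Functions on the circle \<open>\<real>/\<int>\<close> are represented by 1-periodic functions on \<open>\<real>\<close>, and integration
  over the circle is Lebesgue integration over the fundamental domain \<open>[0, 1]\<close>.
\<close>

definition L2_circle :: "(real \<Rightarrow> complex) set" where
  "L2_circle = {f. (\<forall>x. f (x + 1) = f x) \<and> f \<in> borel_measurable lebesgue \<and>
     set_integrable lebesgue {0..1} (\<lambda>x. (cmod (f x))\<^sup>2)}"

definition quad_log_partial :: "real \<Rightarrow> nat \<Rightarrow> real \<Rightarrow> complex" where
  "quad_log_partial \<alpha> N \<beta> =
     (\<Sum>n=1..N. exp (2 * complex_of_real pi * \<i> *
        complex_of_real (\<alpha> * (real n)\<^sup>2 + \<beta> * real n)) / of_nat n)"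

text \<open>
  The sum of the series is an element of \<open>L\<^sup>2(\<real>/\<int>)\<close>, i.e. a class of functions modulo equality
  almost everywhere. It is given here as that class: the set of all representatives of the
  \<open>L\<^sup>2\<close>-limit of the partial sums. The two lemmas at the end of the theory show that it is
  nonempty for every real \<open>\<alpha>\<close> and that it consists of one class modulo null sets.
\<close>

definition quad_log_series :: "real \<Rightarrow> (real \<Rightarrow> complex) set" where
  "quad_log_series \<alpha> = {f \<in> L2_circle.
     (\<lambda>N. LINT \<beta>:{0..1}|lebesgue. (cmod (quad_log_partial \<alpha> N \<beta> - f \<beta>))\<^sup>2) \<longlonglongrightarrow> 0}"

definition quad_log_abel :: "real \<Rightarrow> real \<Rightarrow> complex" where
  "quad_log_abel \<alpha> r =
     (\<Sum>k. exp (2 * complex_of_real pi * \<i> * complex_of_real (\<alpha> * (real (Suc k))\<^sup>2))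
        / of_nat (Suc k) * of_real (r ^ Suc k))"


subsection \<open>Existence and uniqueness of the \<open>L\<^sup>2\<close> sum\<close>

definition quad_log_coeff :: "real \<Rightarrow> nat \<Rightarrow> complex" where
  "quad_log_coeff \<alpha> n = exp (2 * complex_of_real pi * \<i> * complex_of_real (\<alpha> * (real n)\<^sup>2)) / of_nat n"

lemma quad_log_partial_eq:
  "quad_log_partial \<alpha> N x = (\<Sum>n=1..N. quad_log_coeff \<alpha> n * cis (2 * pi * real n * x))"
  unfolding quad_log_partial_def quad_log_coeff_def cis_conv_exp
  by (intro sum.cong refl) (simp add: exp_add [symmetric] algebra_simps)

lemma cmod_quad_log_coeff: "cmod (quad_log_coeff \<alpha> n) = 1 / real n"
proof -
  have "cmod (exp (2 * complex_of_real pi * \<i> * complex_of_real (\<alpha> * (real n)\<^sup>2))) = 1"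
    by (simp add: norm_exp_eq_Re)
  then show ?thesis by (simp add: quad_log_coeff_def norm_divide)
qed

lemma continuous_quad_log_partial: "continuous_on S (quad_log_partial \<alpha> N)"
  unfolding quad_log_partial_def by (intro continuous_intros) auto

lemma quad_log_partial_periodic: "quad_log_partial \<alpha> N (x + 1) = quad_log_partial \<alpha> N x"
proof -
  have "cis (2 * pi * real n * (x + 1)) = cis (2 * pi * real n * x)" for n
  proof -
    have "cis (2 * pi * real n * (x + 1)) = cis (2 * pi * real n * x) * cis (2 * pi * real n)"
      by (simp add: cis_mult algebra_simps)
    also have "cis (2 * pi * real n) = 1" by (simp add: cis_multiple_2pi)
    finally show ?thesis by simp
  qed
  then show ?thesis by (simp add: quad_log_partial_eq)
qed

lemma has_integral_cis_int:
  "((\<lambda>x. cis (2 * pi * real_of_int k * x)) has_integral (if k = 0 then 1 else 0)) {0..1}"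
proof (cases "k = 0")
  case True
  then show ?thesis using has_integral_const_real [of "1::complex" 0 1] by simp
next
  case False
  define c where "c = 2 * pi * real_of_int k"
  have c: "c \<noteq> 0" using False by (simp add: c_def)
  have "((\<lambda>x. cis (c * x)) has_integral (cis (c * 1) / (\<i> * of_real c) - cis (c * 0) / (\<i> * of_real c))) {0..1}"
  proof (rule fundamental_theorem_of_calculus)
    fix x :: real
    have "((\<lambda>z. exp (\<i> * of_real c * z) / (\<i> * of_real c)) has_field_derivative exp (\<i> * of_real c * of_real x))
            (at (of_real x))"
      using c by (auto intro!: derivative_eq_intros)
    then have "((\<lambda>x. exp (\<i> * of_real c * of_real x) / (\<i> * of_real c)) has_vector_derivative
        exp (\<i> * of_real c * of_real x)) (at x within {0..1})"
      by (rule has_vector_derivative_real_field)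
    then show "((\<lambda>x. cis (c * x) / (\<i> * of_real c)) has_vector_derivative cis (c * x)) (at x within {0..1})"
      by (simp add: cis_conv_exp mult_ac)
  qed simp
  moreover have "cis (c * 1) = 1"
    using cis_multiple_2pi [of "real_of_int k"] by (simp add: c_def)
  ultimately show ?thesis using False by (simp add: c_def)
qed

lemma integral_quad_log_partial_diff:
  assumes "M \<le> N"
  shows "(LINT x:{0..1}|lebesgue. (cmod (quad_log_partial \<alpha> N x - quad_log_partial \<alpha> M x))\<^sup>2)
          = (\<Sum>n\<in>{M<..N}. 1 / (real n)\<^sup>2)"
proof -
  define a where "a = quad_log_coeff \<alpha>"
  define D where "D = (\<lambda>x. quad_log_partial \<alpha> N x - quad_log_partial \<alpha> M x)"
  have D: "D x = (\<Sum>n\<in>{M<..N}. a n * cis (2 * pi * real n * x))" for x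
  proof -
    have "{1..N} = {1..M} \<union> {M<..N}" using assms by auto
    then have "quad_log_partial \<alpha> N x = (\<Sum>n\<in>{1..M} \<union> {M<..N}. a n * cis (2 * pi * real n * x))"
      by (simp add: quad_log_partial_eq a_def)
    also have "\<dots> = quad_log_partial \<alpha> M x + (\<Sum>n\<in>{M<..N}. a n * cis (2 * pi * real n * x))"
      by (subst sum.union_disjoint) (auto simp: quad_log_partial_eq a_def)
    finally show ?thesis by (simp add: D_def)
  qed
  have sq: "complex_of_real ((cmod (D x))\<^sup>2) =
      (\<Sum>i\<in>{M<..N}. \<Sum>j\<in>{M<..N}. a i * cnj (a j) * cis (2 * pi * real_of_int (int i - int j) * x))" for x
  proof -
    have "complex_of_real ((cmod (D x))\<^sup>2) = D x * cnj (D x)"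
      by (rule complex_norm_square)
    also have "\<dots> = (\<Sum>i\<in>{M<..N}. \<Sum>j\<in>{M<..N}.
        (a i * cis (2 * pi * real i * x)) * (cnj (a j) * cis (- (2 * pi * real j * x))))"
      by (simp add: D sum_product cis_cnj)
    also have "\<dots> = (\<Sum>i\<in>{M<..N}. \<Sum>j\<in>{M<..N}. a i * cnj (a j) * cis (2 * pi * real_of_int (int i - int j) * x))"
    proof (intro sum.cong refl)
      fix i j
      have "cis (2 * pi * real i * x) * cis (- (2 * pi * real j * x)) = cis (2 * pi * real_of_int (int i - int j) * x)"
        by (simp add: cis_mult algebra_simps)
      then show "(a i * cis (2 * pi * real i * x)) * (cnj (a j) * cis (- (2 * pi * real j * x)))
          = a i * cnj (a j) * cis (2 * pi * real_of_int (int i - int j) * x)"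
        by (metis (no_types, opaque_lifting) mult.assoc mult.left_commute)
    qed
    finally show ?thesis .
  qed
  have "((\<lambda>x. complex_of_real ((cmod (D x))\<^sup>2)) has_integral
      (\<Sum>i\<in>{M<..N}. \<Sum>j\<in>{M<..N}. a i * cnj (a j) * (if int i - int j = 0 then 1 else 0))) {0..1}"
    unfolding sq
    by (intro has_integral_sum has_integral_mult_right has_integral_cis_int) auto
  moreover have "(\<Sum>i\<in>{M<..N}. \<Sum>j\<in>{M<..N}. a i * cnj (a j) * (if int i - int j = 0 then 1 else 0))
     = (\<Sum>i\<in>{M<..N}. complex_of_real (1 / (real i)\<^sup>2))"
  proof (intro sum.cong refl)
    fix i assume i: "i \<in> {M<..N}"
    have "(\<Sum>j\<in>{M<..N}. a i * cnj (a j) * (if int i - int j = 0 then 1 else 0))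
        = (\<Sum>j\<in>{M<..N}. if i = j then a i * cnj (a j) else 0)"
      by (intro sum.cong) auto
    also have "\<dots> = a i * cnj (a i)" using i by simp
    also have "\<dots> = complex_of_real (1 / (real i)\<^sup>2)"
      by (simp add: complex_norm_square [symmetric] a_def cmod_quad_log_coeff power_divide
          del: of_real_power of_real_divide)
    finally show "(\<Sum>j\<in>{M<..N}. a i * cnj (a j) * (if int i - int j = 0 then 1 else 0))
        = complex_of_real (1 / (real i)\<^sup>2)" .
  qed
  ultimately have "((\<lambda>x. complex_of_real ((cmod (D x))\<^sup>2)) has_integral
      (\<Sum>i\<in>{M<..N}. complex_of_real (1 / (real i)\<^sup>2))) {0..1}" by simp
  from has_integral_linear [OF this bounded_linear_Re]
  have I: "((\<lambda>x. (cmod (D x))\<^sup>2) has_integral (\<Sum>i\<in>{M<..N}. 1 / (real i)\<^sup>2)) {0..1}"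
    by (simp add: o_def Re_sum del: of_real_power of_real_divide)
  have "continuous_on {0..1} (\<lambda>x. (cmod (D x))\<^sup>2)"
    unfolding D_def by (intro continuous_intros continuous_quad_log_partial)
  then have "set_integrable lebesgue {0..1} (\<lambda>x. (cmod (D x))\<^sup>2)"
    by (rule absolutely_integrable_continuous_real)
  from set_lebesgue_integral_eq_integral(2) [OF this] I show ?thesis
    by (simp add: D_def integral_unique)
qed

lemma sum_inverse_squares_le:
  assumes "M \<ge> 1" "M \<le> N"
  shows "(\<Sum>n\<in>{M<..N}. 1 / (real n)\<^sup>2) \<le> 1 / real M - 1 / real N"
  using assms(2)
proof (induction N rule: dec_induct)
  case (step n)
  have "{M<..Suc n} = insert (Suc n) {M<..n}" using step by auto
  then have "(\<Sum>n\<in>{M<..Suc n}. 1 / (real n)\<^sup>2) = 1 / (real (Suc n))\<^sup>2 + (\<Sum>n\<in>{M<..n}. 1 / (real n)\<^sup>2)"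
    by simp
  also have "1 / (real (Suc n))\<^sup>2 \<le> 1 / real n - 1 / real (Suc n)"
  proof -
    have n: "real n > 0" using assms step by simp
    then have "1 / real n - 1 / real (Suc n) = 1 / (real n * real (Suc n))"
      by (simp add: field_simps)
    moreover have "real n * real (Suc n) \<le> (real (Suc n))\<^sup>2"
      unfolding power2_eq_square by (intro mult_right_mono) auto
    ultimately show ?thesis using n by (simp only:) (intro divide_left_mono, auto)
  qed
  finally show ?case using step.IH by simp
qed simp

lemma integral_quad_log_partial_diff_le:
  assumes "M \<ge> 1" "M \<le> N"
  shows "(LINT x:{0..1}|lebesgue. (cmod (quad_log_partial \<alpha> N x - quad_log_partial \<alpha> M x))\<^sup>2) \<le> 1 / real M"
  using sum_inverse_squares_le [OF assms] assms
  by (simp add: integral_quad_log_partial_diff) (smt (verit) divide_nonneg_nonneg of_nat_0_le_iff)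

lemma cmod_add_square_le: "(cmod (a + b))\<^sup>2 \<le> 2 * (cmod a)\<^sup>2 + 2 * (cmod b)\<^sup>2"
proof -
  have "(cmod (a + b))\<^sup>2 \<le> (cmod a + cmod b)\<^sup>2"
    by (intro power_mono norm_triangle_ineq) auto
  also have "\<dots> \<le> 2 * (cmod a)\<^sup>2 + 2 * (cmod b)\<^sup>2"
    using sum_squares_bound [of "cmod a" "cmod b"] by (simp add: power2_sum)
  finally show ?thesis .
qed

lemma quad_log_partial_measurable [measurable]: "quad_log_partial \<alpha> N \<in> borel_measurable borel"
  by (intro borel_measurable_continuous_onI continuous_quad_log_partial)

lemma indicator_square_measurable:
  fixes u :: "real \<Rightarrow> complex"
  assumes "u \<in> borel_measurable lebesgue"
  shows "(\<lambda>x. indicator {0..1} x *\<^sub>R (cmod (u x))\<^sup>2) \<in> borel_measurable lebesgue"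
  by (intro borel_measurable_scaleR borel_measurable_indicator borel_measurable_power
      measurable_compose [OF assms borel_measurable_norm]) auto

lemma set_integrable_square_add:
  fixes u v :: "real \<Rightarrow> complex"
  assumes [measurable]: "u \<in> borel_measurable lebesgue" "v \<in> borel_measurable lebesgue"
    and u: "set_integrable lebesgue {0..1} (\<lambda>x. (cmod (u x))\<^sup>2)"
    and v: "set_integrable lebesgue {0..1} (\<lambda>x. (cmod (v x))\<^sup>2)"
  shows "set_integrable lebesgue {0..1} (\<lambda>x. (cmod (u x + v x))\<^sup>2)"
    and "(LINT x:{0..1}|lebesgue. (cmod (u x + v x))\<^sup>2) \<le>
      2 * (LINT x:{0..1}|lebesgue. (cmod (u x))\<^sup>2) + 2 * (LINT x:{0..1}|lebesgue. (cmod (v x))\<^sup>2)"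
proof -
  have *: "set_integrable lebesgue {0..1} (\<lambda>x. 2 * (cmod (u x))\<^sup>2 + 2 * (cmod (v x))\<^sup>2)"
    using u v by (intro set_integral_add set_integrable_mult_right) auto
  show 1: "set_integrable lebesgue {0..1} (\<lambda>x. (cmod (u x + v x))\<^sup>2)"
  proof (rule set_integrable_bound [OF *])
    have "(\<lambda>x. indicator {0..1} x *\<^sub>R (cmod (u x + v x))\<^sup>2) \<in> borel_measurable lebesgue"
      by (intro indicator_square_measurable borel_measurable_add) fact+
    then show "set_borel_measurable lebesgue {0..1} (\<lambda>x. (cmod (u x + v x))\<^sup>2)"
      by (simp add: set_borel_measurable_def)
  qed (auto simp: cmod_add_square_le)
  have "(LINT x:{0..1}|lebesgue. (cmod (u x + v x))\<^sup>2) \<le>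
      (LINT x:{0..1}|lebesgue. 2 * (cmod (u x))\<^sup>2 + 2 * (cmod (v x))\<^sup>2)"
    by (rule set_integral_mono [OF 1 *]) (rule cmod_add_square_le)
  also have "\<dots> = 2 * (LINT x:{0..1}|lebesgue. (cmod (u x))\<^sup>2) + 2 * (LINT x:{0..1}|lebesgue. (cmod (v x))\<^sup>2)"
    using u v by (subst set_integral_add) auto
  finally show "(LINT x:{0..1}|lebesgue. (cmod (u x + v x))\<^sup>2) \<le>
      2 * (LINT x:{0..1}|lebesgue. (cmod (u x))\<^sup>2) + 2 * (LINT x:{0..1}|lebesgue. (cmod (v x))\<^sup>2)" .
qed

lemma quad_log_partial_measurable' [measurable]: "quad_log_partial \<alpha> N \<in> borel_measurable lebesgue"
  using quad_log_partial_measurable by (simp add: measurable_completion)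

lemma set_integrable_continuous_square:
  fixes f :: "real \<Rightarrow> complex"
  assumes "continuous_on {0..1} f"
  shows "set_integrable lebesgue {0..1} (\<lambda>x. (cmod (f x))\<^sup>2)"
  by (intro absolutely_integrable_continuous_real continuous_intros assms)

lemma quad_log_series_AE_unique:
  assumes "f \<in> quad_log_series \<alpha>" "g \<in> quad_log_series \<alpha>"
  shows "AE x in lebesgue. x \<in> {0..1} \<longrightarrow> f x = g x"
proof -
  define S where "S = quad_log_partial \<alpha>"
  have [measurable]: "f \<in> borel_measurable lebesgue" "g \<in> borel_measurable lebesgue"
       "\<And>N. S N \<in> borel_measurable lebesgue"
    and fi: "set_integrable lebesgue {0..1} (\<lambda>x. (cmod (f x))\<^sup>2)"
    and gi: "set_integrable lebesgue {0..1} (\<lambda>x. (cmod (g x))\<^sup>2)"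
    and fl: "(\<lambda>N. LINT x:{0..1}|lebesgue. (cmod (S N x - f x))\<^sup>2) \<longlonglongrightarrow> 0"
    and gl: "(\<lambda>N. LINT x:{0..1}|lebesgue. (cmod (S N x - g x))\<^sup>2) \<longlonglongrightarrow> 0"
    using assms by (auto simp: quad_log_series_def L2_circle_def S_def)
  have Si: "set_integrable lebesgue {0..1} (\<lambda>x. (cmod (S N x))\<^sup>2)" for N
    unfolding S_def by (intro set_integrable_continuous_square continuous_quad_log_partial)
  have Sf: "set_integrable lebesgue {0..1} (\<lambda>x. (cmod (S N x - f x))\<^sup>2)" for N
    using set_integrable_square_add(1) [of "S N" "\<lambda>x. - f x"] Si fi by simp
  have Sg: "set_integrable lebesgue {0..1} (\<lambda>x. (cmod (S N x - g x))\<^sup>2)" for N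
    using set_integrable_square_add(1) [of "S N" "\<lambda>x. - g x"] Si gi by simp
  have fg: "set_integrable lebesgue {0..1} (\<lambda>x. (cmod (f x - g x))\<^sup>2)"
    using set_integrable_square_add(1) [of f "\<lambda>x. - g x"] fi gi by simp
  define I where "I = (LINT x:{0..1}|lebesgue. (cmod (f x - g x))\<^sup>2)"
  have "I \<le> 2 * (LINT x:{0..1}|lebesgue. (cmod (S N x - f x))\<^sup>2)
          + 2 * (LINT x:{0..1}|lebesgue. (cmod (S N x - g x))\<^sup>2)" for N
    using set_integrable_square_add(2) [of "\<lambda>x. f x - S N x" "\<lambda>x. S N x - g x"] Sf [of N] Sg [of N]
    by (simp add: I_def norm_minus_commute)
  moreover have "(\<lambda>N. 2 * (LINT x:{0..1}|lebesgue. (cmod (S N x - f x))\<^sup>2)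
          + 2 * (LINT x:{0..1}|lebesgue. (cmod (S N x - g x))\<^sup>2)) \<longlonglongrightarrow> 2 * 0 + 2 * 0"
    by (intro tendsto_intros fl gl)
  ultimately have "I \<le> 2 * 0 + 2 * 0"
    by (intro LIMSEQ_le_const) auto
  moreover have "I \<ge> 0" unfolding I_def set_lebesgue_integral_def by (rule integral_nonneg_AE) auto
  ultimately have "I = 0" by simp
  then have "(LINT x|lebesgue. indicator {0..1} x *\<^sub>R (cmod (f x - g x))\<^sup>2) = 0"
    by (simp add: I_def set_lebesgue_integral_def)
  then have "AE x in lebesgue. indicator {0..1} x *\<^sub>R (cmod (f x - g x))\<^sup>2 = 0"
    using fg by (subst (asm) integral_nonneg_eq_0_iff_AE) (auto simp: set_integrable_def)
  then show ?thesis by eventually_elim (auto simp: indicator_def)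
qed

lemma quad_log_series_nonempty: "quad_log_series \<alpha> \<noteq> {}"
proof -
  define S where "S = quad_log_partial \<alpha>"
  define P where "P = (\<lambda>k::nat. (16::nat) ^ k)"
  define d where "d = (\<lambda>k x. S (P (Suc k)) x - S (P k) x)"
  define f where "f = (\<lambda>x. lim (\<lambda>k. S (P k) x))"
  have [measurable]: "S N \<in> borel_measurable lebesgue" for N by (simp add: S_def)
  have [measurable]: "d k \<in> borel_measurable lebesgue" for k unfolding d_def by measurable
  have fm [measurable]: "f \<in> borel_measurable lebesgue" unfolding f_def by measurable
  have Si: "set_integrable lebesgue {0..1} (\<lambda>x. (cmod (S N x))\<^sup>2)" for N
    unfolding S_def by (intro set_integrable_continuous_square continuous_quad_log_partial)
  have di: "set_integrable lebesgue {0..1} (\<lambda>x. (cmod (d k x))\<^sup>2)" for k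
    unfolding d_def S_def
    by (intro set_integrable_continuous_square continuous_intros continuous_quad_log_partial)
  have P1: "P k \<ge> 1" and PSuc: "P k \<le> P (Suc k)" and kP: "k \<le> P k" for k
  proof -
    show "P k \<ge> 1" "P k \<le> P (Suc k)" by (auto simp: P_def)
    have "k < 2 ^ k" by (rule less_exp)
    also have "(2::nat) ^ k \<le> 16 ^ k" by (intro power_mono) auto
    finally show "k \<le> P k" by (simp add: P_def)
  qed
  have dI: "(LINT x:{0..1}|lebesgue. (cmod (d k x))\<^sup>2) \<le> (1/16) ^ k" for k
    using integral_quad_log_partial_diff_le [OF P1 [of k] PSuc [of k], of \<alpha>]
    by (simp add: d_def S_def P_def power_divide)
  define w where "w = (\<lambda>k x. 4 ^ k * (indicator {0..1} x * (cmod (d k x))\<^sup>2) :: real)"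
  have wi: "integrable lebesgue (w k)" for k
    using di [of k] by (auto simp: w_def set_integrable_def)
  have w0: "w k x \<ge> 0" for k x by (simp add: w_def)
  have wI: "(LINT x|lebesgue. w k x) \<le> (1/4) ^ k" for k
  proof -
    have "(LINT x|lebesgue. w k x) = 4 ^ k * (LINT x:{0..1}|lebesgue. (cmod (d k x))\<^sup>2)"
      by (simp add: w_def set_lebesgue_integral_def)
    also have "\<dots> \<le> 4 ^ k * (1/16) ^ k" using dI by (intro mult_left_mono) auto
    also have "\<dots> = (1/4) ^ k" by (simp add: power_mult_distrib [symmetric])
    finally show ?thesis .
  qed
  have AEs: "AE x in lebesgue. summable (\<lambda>k. w k x)"
  proof -
    have "(\<integral>\<^sup>+x. (\<Sum>k. ennreal (w k x)) \<partial>lebesgue) = (\<Sum>k. \<integral>\<^sup>+x. ennreal (w k x) \<partial>lebesgue)"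
      using wi by (intro nn_integral_suminf) auto
    also have "\<dots> = (\<Sum>k. ennreal (LINT x|lebesgue. w k x))"
      using wi w0 by (intro suminf_cong nn_integral_eq_integral) auto
    also have "\<dots> \<le> (\<Sum>k. ennreal ((1/4) ^ k))"
      by (intro suminf_le ennreal_leI wI) auto
    also have "\<dots> = ennreal (\<Sum>k. (1/4) ^ k)"
      by (intro suminf_ennreal2 summable_geometric) auto
    finally have "(\<integral>\<^sup>+x. (\<Sum>k. ennreal (w k x)) \<partial>lebesgue) \<noteq> \<infinity>"
      by (auto simp: top_unique)
    moreover have "(\<lambda>x. \<Sum>k. ennreal (w k x)) \<in> borel_measurable lebesgue"
      using wi by (intro borel_measurable_suminf_order) auto
    ultimately have "AE x in lebesgue. (\<Sum>k. ennreal (w k x)) \<noteq> \<infinity>"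
      by (intro nn_integral_PInf_AE)
    then show ?thesis
    proof eventually_elim
      case (elim x)
      then show ?case using summable_suminf_not_top [OF w0] by simp
    qed
  qed
  define h where "h = (\<lambda>x. \<Sum>k. w k x)"
  have hi: "integrable lebesgue h"
    unfolding h_def
  proof (rule integrable_suminf)
    show "summable (\<lambda>k. LINT x|lebesgue. norm (w k x))"
    proof (rule summable_comparison_test [of _ "\<lambda>k. (1/4) ^ k"])
      show "\<exists>N. \<forall>n\<ge>N. norm (LINT x|lebesgue. norm (w n x)) \<le> (1/4) ^ n"
        using wI w0 by simp
    qed auto
  qed (use wi w0 AEs in auto)
  have ptw: "(cmod (f x - S (P K) x))\<^sup>2 \<le> 4 * (1/4) ^ K * h x"
    if sm: "summable (\<lambda>k. w k x)" and x: "x \<in> {0..1}" for x K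
  proof -
    have h0: "h x \<ge> 0" unfolding h_def by (intro suminf_nonneg sm w0)
    have db: "cmod (d k x) \<le> (1/2) ^ k * sqrt (h x)" for k
    proof -
      have "w k x \<le> h x"
        unfolding h_def using sum_le_suminf [OF sm, of "{k}"] w0 by simp
      then have "4 ^ k * (cmod (d k x))\<^sup>2 \<le> h x" using x by (simp add: w_def)
      then have "(2 ^ k * cmod (d k x))\<^sup>2 \<le> h x"
        by (simp add: power_mult_distrib power_mult [symmetric] mult.commute [of k 2] power_mult)
      then have "2 ^ k * cmod (d k x) \<le> sqrt (h x)" by (rule real_le_rsqrt)
      then show ?thesis by (simp add: field_simps power_divide)
    qed
    have ds: "summable (\<lambda>k. d (k + K) x)"
    proof (rule summable_comparison_test [of _ "\<lambda>k. (1/2) ^ (k + K) * sqrt (h x)"])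
      show "summable (\<lambda>k. (1/2) ^ (k + K) * sqrt (h x))"
        by (intro summable_mult2 summable_ignore_initial_segment summable_geometric) auto
    qed (use db in auto)
    have tel: "(\<Sum>k<n. d (k + K) x) = S (P (n + K)) x - S (P K) x" for n
      by (induction n) (auto simp: d_def)
    have "(\<lambda>n. S (P (n + K)) x - S (P K) x) \<longlonglongrightarrow> (\<Sum>k. d (k + K) x)"
      using summable_LIMSEQ [OF ds] by (simp add: tel)
    then have "(\<lambda>n. S (P (n + K)) x - S (P K) x + S (P K) x) \<longlonglongrightarrow> (\<Sum>k. d (k + K) x) + S (P K) x"
      by (intro tendsto_intros)
    then have "(\<lambda>n. S (P (n + K)) x) \<longlonglongrightarrow> (\<Sum>k. d (k + K) x) + S (P K) x" by simp
    then have "(\<lambda>n. S (P n) x) \<longlonglongrightarrow> (\<Sum>k. d (k + K) x) + S (P K) x"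
      by (rule LIMSEQ_offset)
    then have "f x = (\<Sum>k. d (k + K) x) + S (P K) x" unfolding f_def by (rule limI)
    then have "cmod (f x - S (P K) x) = cmod (\<Sum>k. d (k + K) x)" by simp
    also have "\<dots> \<le> (\<Sum>k. (1/2) ^ (k + K) * sqrt (h x))"
      by (intro norm_suminf_le db summable_mult2 summable_ignore_initial_segment summable_geometric) auto
    also have "\<dots> = (\<Sum>k. (1/2) ^ k) * ((1/2) ^ K * sqrt (h x))"
      by (subst suminf_mult2) (auto simp: power_add mult_ac intro: summable_geometric)
    also have "\<dots> = 2 * (1/2) ^ K * sqrt (h x)"
      by (subst suminf_geometric) auto
    finally have "(cmod (f x - S (P K) x))\<^sup>2 \<le> (2 * (1/2) ^ K * sqrt (h x))\<^sup>2"
      by (intro power_mono) auto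
    also have "\<dots> = 4 * (1/4) ^ K * h x"
      using h0 by (simp add: power_mult_distrib power_mult [symmetric] mult.commute [of K 2] power_divide)
        (simp add: power_mult)
    finally show ?thesis .
  qed
  have ptw': "AE x in lebesgue. indicator {0..1} x * (cmod (f x - S (P K) x))\<^sup>2 \<le> 4 * (1/4) ^ K * h x" for K
    using AEs
  proof eventually_elim
    case (elim x)
    have "h x \<ge> 0" unfolding h_def by (intro suminf_nonneg elim w0)
    then show ?case using ptw [OF elim, of K] by (auto simp: indicator_def)
  qed
  have fSi: "set_integrable lebesgue {0..1} (\<lambda>x. (cmod (f x - S (P K) x))\<^sup>2)" for K
    unfolding set_integrable_def
  proof (rule Bochner_Integration.integrable_bound)
    show "integrable lebesgue (\<lambda>x. 4 * (1/4) ^ K * h x)" using hi by simp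
    show "AE x in lebesgue. norm (indicator {0..1} x *\<^sub>R (cmod (f x - S (P K) x))\<^sup>2) \<le> norm (4 * (1/4) ^ K * h x)"
      using ptw' [of K] by eventually_elim (smt (verit) indicator_pos_le mult_nonneg_nonneg real_norm_def real_scaleR_def zero_le_power2)
  qed (intro indicator_square_measurable borel_measurable_diff; measurable)
  have fi: "set_integrable lebesgue {0..1} (\<lambda>x. (cmod (f x))\<^sup>2)"
    using set_integrable_square_add(1) [of "\<lambda>x. f x - S (P 0) x" "S (P 0)"] fSi Si by simp
  define H where "H = (LINT x|lebesgue. h x)"
  have fSI: "(LINT x:{0..1}|lebesgue. (cmod (f x - S (P K) x))\<^sup>2) \<le> 4 * (1/4) ^ K * H" for K
  proof -
    have "(LINT x:{0..1}|lebesgue. (cmod (f x - S (P K) x))\<^sup>2) \<le> (LINT x|lebesgue. 4 * (1/4) ^ K * h x)"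
      unfolding set_lebesgue_integral_def
      using fSi [of K] hi ptw' [of K] by (intro integral_mono_AE) (auto simp: set_integrable_def)
    then show ?thesis by (simp add: H_def)
  qed
  have bnd: "(LINT x:{0..1}|lebesgue. (cmod (S N x - f x))\<^sup>2) \<le> 2 * (1 / real (P K)) + 2 * (4 * (1/4) ^ K * H)"
    if "N \<ge> P K" for N K
  proof -
    have "set_integrable lebesgue {0..1} (\<lambda>x. (cmod (S N x - S (P K) x))\<^sup>2)"
      unfolding S_def
      by (intro set_integrable_continuous_square continuous_intros continuous_quad_log_partial)
    then have "(LINT x:{0..1}|lebesgue. (cmod (S N x - f x))\<^sup>2) \<le>
       2 * (LINT x:{0..1}|lebesgue. (cmod (S N x - S (P K) x))\<^sup>2)
       + 2 * (LINT x:{0..1}|lebesgue. (cmod (f x - S (P K) x))\<^sup>2)"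
      using set_integrable_square_add(2) [of "\<lambda>x. S N x - S (P K) x" "\<lambda>x. S (P K) x - f x"] fSi [of K]
      by (simp add: norm_minus_commute)
    also have "\<dots> \<le> 2 * (1 / real (P K)) + 2 * (4 * (1/4) ^ K * H)"
      using integral_quad_log_partial_diff_le [OF P1 that, of \<alpha>] fSI [of K]
      unfolding S_def by (intro add_mono mult_left_mono) auto
    finally show ?thesis .
  qed
  have "(\<lambda>N. LINT x:{0..1}|lebesgue. (cmod (S N x - f x))\<^sup>2) \<longlonglongrightarrow> 0"
  proof (rule LIMSEQ_I)
    fix e :: real assume e: "e > 0"
    have "(\<lambda>K. 2 * (1/16) ^ K + 2 * (4 * (1/4) ^ K * H)) \<longlonglongrightarrow> 2 * 0 + 2 * (4 * 0 * H)"
      by (intro tendsto_intros LIMSEQ_power_zero) auto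
    then have "eventually (\<lambda>K. 2 * (1/16) ^ K + 2 * (4 * (1/4) ^ K * H) < e) sequentially"
      using e by (intro order_tendstoD(2)) auto
    then obtain K where K: "2 * (1/16) ^ K + 2 * (4 * (1/4) ^ K * H) < e"
      by (auto simp: eventually_sequentially)
    have PK: "1 / real (P K) = (1/16) ^ K" by (simp add: P_def power_divide)
    show "\<exists>no. \<forall>N\<ge>no. norm ((LINT x:{0..1}|lebesgue. (cmod (S N x - f x))\<^sup>2) - 0) < e"
    proof (intro exI [of _ "P K"] allI impI)
      fix N assume "N \<ge> P K"
      from bnd [OF this] K PK
      have "(LINT x:{0..1}|lebesgue. (cmod (S N x - f x))\<^sup>2) < e" by simp
      moreover have "(LINT x:{0..1}|lebesgue. (cmod (S N x - f x))\<^sup>2) \<ge> 0"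
        unfolding set_lebesgue_integral_def by (rule integral_nonneg_AE) auto
      ultimately show "norm ((LINT x:{0..1}|lebesgue. (cmod (S N x - f x))\<^sup>2) - 0) < e" by simp
    qed
  qed
  moreover have "f (x + 1) = f x" for x by (simp add: f_def S_def quad_log_partial_periodic)
  ultimately have "f \<in> quad_log_series \<alpha>"
    using fi fm by (auto simp: quad_log_series_def L2_circle_def S_def)
  then show ?thesis by blast
qed

end

theory Submission
  imports Defs "HOL-Real_Asymp.Real_Asymp"
begin

text \<open>
  Write \<open>A\<^sub>\<alpha>(r)\<close> for the Abel mean and \<open>e(x) = exp(2\<pi>ix)\<close>. At a rational frequency
  \<open>\<alpha> = a/q\<close> the numbers \<open>e(\<alpha>n\<^sup>2)\<close> are periodic in \<open>n\<close>, and summation by parts shows that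
  \<open>A\<^sub>\<alpha>(r)\<close> is their mean times \<open>log (1/(1 - r))\<close>, up to a bounded error. The mean is the Gauss sum
  divided by \<open>q\<close>, and the Gauss sum has modulus \<open>\<surd>q\<close> when \<open>q\<close> is odd and \<open>a\<close> is coprime to \<open>q\<close>.
  Hence \<open>A\<^sub>\<alpha>\<close> is unbounded near \<open>1\<close> on a dense set of rationals
  (\<open>quad_log_abel_rational_unbounded\<close>).

  For fixed \<open>r < 1\<close> the mean depends continuously on \<open>\<alpha>\<close>, so the condition that \<open>\<bar>A\<^sub>\<alpha>(r)\<bar>\<close>
  exceeds \<open>M\<close> for some \<open>r\<close> within \<open>1/(M + 1)\<close> of \<open>1\<close> defines an open set, and this set is dense
  because it contains those rationals. By Baire's theorem the intersection of these sets over all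
  \<open>M\<close> with the complements of the rational points is nonempty: it yields an irrational \<open>\<alpha>\<close> with
  unbounded Abel means (\<open>exists_irrational_unbounded_abel\<close>).

  If the class \<open>\<F>\<^sub>\<alpha>\<close> had a continuous representative \<open>g\<close>, then \<open>A\<^sub>\<alpha>(r)\<close> would be the Poisson
  integral of \<open>g\<close> at \<open>0\<close>, hence bounded by the maximum of \<open>\<bar>g\<bar>\<close>, since the Poisson kernel is positive
  with integral \<open>1\<close> (\<open>continuous_representative_imp_Bfun_abel\<close>). The proof replaces the Poisson
  kernel by positive trigonometric polynomials, which keeps every integral a finite sum.
\<close>

section \<open>Abel means of periodic sequences\<close>

text \<open>
  After summation by parts the partial sums of \<open>c\<close> are multiplied by the nonnegative numbers
  \<open>w\<^sub>k - w\<^sub>k\<^sub>+\<^sub>1\<close> and \<open>w\<^sub>n\<close>, whose total is \<open>w\<^sub>0\<close>.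
\<close>

lemma norm_sum_mult_decseq_le:
  fixes c :: "nat \<Rightarrow> 'a::real_normed_vector" and w :: "nat \<Rightarrow> real"
  assumes B: "\<And>n. norm (\<Sum>k<n. c k) \<le> B"
    and w: "decseq w" "\<And>n. 0 \<le> w n"
  shows "norm (\<Sum>k<n. w k *\<^sub>R c k) \<le> B * w 0"
proof -
  define S where "S n = (\<Sum>k<n. c k)" for n
  have parts: "(\<Sum>k<n. w k *\<^sub>R c k) = w n *\<^sub>R S n + (\<Sum>k<n. (w k - w (Suc k)) *\<^sub>R S (Suc k))"
    by (induction n) (auto simp: S_def algebra_simps)
  have "norm (\<Sum>k<n. w k *\<^sub>R c k)
      \<le> w n * norm (S n) + (\<Sum>k<n. (w k - w (Suc k)) * norm (S (Suc k)))"
    unfolding parts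
    by (rule order_trans [OF norm_triangle_ineq], rule add_mono, use w in simp,
        rule order_trans [OF norm_sum], use decseqD [OF w(1)] in \<open>simp add: abs_of_nonneg\<close>)
  also have "\<dots> \<le> w n * B + (\<Sum>k<n. (w k - w (Suc k)) * B)"
    using B w decseqD [OF w(1)] unfolding S_def
    by (intro add_mono sum_mono mult_left_mono) (auto simp del: sum.lessThan_Suc)
  also have "(\<Sum>k<n. (w k - w (Suc k)) * B) = (w 0 - w n) * B"
    by (simp add: sum_distrib_right [symmetric] sum_lessThan_telescope')
  finally show ?thesis by (simp add: algebra_simps)
qed

text \<open>Complete periods contribute nothing, so a partial sum equals a sum over part of one period.\<close>

lemma norm_partial_sum_periodic_le:
  fixes c :: "nat \<Rightarrow> 'a::real_normed_vector"
  assumes q: "q > 0" and per: "\<And>n. c (n + q) = c n" and zero: "(\<Sum>k<q. c k) = 0"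
  shows "norm (\<Sum>k<n. c k) \<le> (\<Sum>k<q. norm (c k))"
proof (induction n rule: less_induct)
  case (less n)
  show ?case
  proof (cases "n < q")
    case True
    have "norm (\<Sum>k<n. c k) \<le> (\<Sum>k<n. norm (c k))" by (rule norm_sum)
    also have "\<dots> \<le> (\<Sum>k<q. norm (c k))" using True by (intro sum_mono2) auto
    finally show ?thesis .
  next
    case False
    then obtain m where n: "n = q + m" using le_Suc_ex not_less by blast
    have "(\<Sum>k<q + m. c k) = (\<Sum>k<q. c k) + (\<Sum>k<m. c (k + q))"
      by (induction m) (auto simp: ac_simps)
    then show ?thesis using less [of m] q n by (simp add: per zero)
  qed
qed

lemma sums_power_over_Suc:
  fixes r :: real
  assumes "0 < r" "r < 1"
  shows "(\<lambda>k. r ^ Suc k / real (Suc k)) sums (- ln (1 - r))"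
proof -
  have "(\<lambda>n. - ((- (- r)) ^ n) / real n) sums ln (1 + - r)"
    using assms by (intro ln_series') auto
  then have "(\<lambda>n. r ^ n / real n) sums (- ln (1 - r))"
    using sums_minus by fastforce
  then show ?thesis by (subst sums_Suc_iff) simp
qed

text \<open>
  Split \<open>c = \<mu> + d\<close> with \<open>\<mu>\<close> the mean over a period. The constant part gives
  \<open>- \<mu> ln (1 - r)\<close>, which diverges. The part \<open>d\<close> has bounded partial sums and is weighted by the
  decreasing sequence \<open>r\<^sup>k\<^sup>+\<^sup>1/(k + 1)\<close>, so it stays bounded uniformly in \<open>r\<close>.
\<close>

lemma abel_mean_periodic_unbounded:
  fixes c :: "nat \<Rightarrow> complex"
  assumes q: "q > 0" and per: "\<And>n. c (n + q) = c n" and nz: "(\<Sum>k<q. c k) \<noteq> 0"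
  shows "\<not> Bfun (\<lambda>r::real. \<Sum>k. c k / of_nat (Suc k) * of_real (r ^ Suc k)) (at_left 1)"
proof
  define A where "A = (\<lambda>r::real. \<Sum>k. c k / of_nat (Suc k) * of_real (r ^ Suc k))"
  assume "Bfun (\<lambda>r::real. \<Sum>k. c k / of_nat (Suc k) * of_real (r ^ Suc k)) (at_left 1)"
  then obtain K where K: "\<forall>\<^sub>F r in at_left 1. cmod (A r) \<le> K"
    unfolding Bfun_def A_def by blast
  define \<mu> where "\<mu> = (\<Sum>k<q. c k) / of_nat q"
  define d where "d k = c k - \<mu>" for k
  define B where "B = (\<Sum>k<q. norm (d k))"
  have "(\<Sum>k<q. d k) = 0" using q by (simp add: d_def sum_subtractf \<mu>_def)
  then have dB: "cmod (\<Sum>k<n. d k) \<le> B" for n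
    unfolding B_def using q per by (intro norm_partial_sum_periodic_le) (auto simp: d_def)
  have B0: "0 \<le> B" unfolding B_def by (intro sum_nonneg) auto
  have bound: "cmod \<mu> * - ln (1 - r) \<le> cmod (A r) + B" if r: "0 < r" "r < 1" for r
  proof -
    define w where "w k = r ^ Suc k / real (Suc k)" for k
    have ws: "w sums (- ln (1 - r))" unfolding w_def using r by (rule sums_power_over_Suc)
    have "decseq w"
      unfolding w_def decseq_Suc_iff using r
      by (intro allI frac_le power_decreasing) auto
    then have db: "cmod (\<Sum>k<n. w k *\<^sub>R d k) \<le> B * w 0" for n
      using r by (intro norm_sum_mult_decseq_le dB \<open>decseq w\<close>) (simp add: w_def)
    have cb: "cmod (c k) \<le> Max (cmod ` c ` {..<q})" for k
    proof (induction k rule: less_induct)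
      case (less k)
      show ?case
      proof (cases "k < q")
        case False
        then show ?thesis using less [of "k - q"] per [of "k - q"] q by simp
      qed auto
    qed
    have "summable (\<lambda>k. w k *\<^sub>R c k)"
    proof (rule summable_comparison_test)
      show "summable (\<lambda>k. w k * Max (cmod ` c ` {..<q}))"
        using ws by (intro summable_mult2) (simp add: sums_iff)
      show "\<exists>N. \<forall>n\<ge>N. norm (w n *\<^sub>R c n) \<le> w n * Max (cmod ` c ` {..<q})"
        using cb r by (auto simp: w_def intro!: divide_right_mono mult_left_mono)
    qed
    moreover have "(\<lambda>k. w k *\<^sub>R c k) = (\<lambda>k. c k / of_nat (Suc k) * of_real (r ^ Suc k))"
      by (auto simp: w_def scaleR_conv_of_real fun_eq_iff)
    ultimately have "(\<lambda>k. w k *\<^sub>R c k) sums A r" by (simp add: A_def summable_sums)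
    moreover have "(\<lambda>k. w k *\<^sub>R \<mu>) sums ((- ln (1 - r)) *\<^sub>R \<mu>)"
      by (intro sums_scaleR_left ws)
    ultimately have "(\<lambda>k. w k *\<^sub>R d k) sums (A r - (- ln (1 - r)) *\<^sub>R \<mu>)"
      unfolding d_def scaleR_diff_right by (rule sums_diff)
    then have "(\<lambda>n. cmod (\<Sum>k<n. w k *\<^sub>R d k)) \<longlonglongrightarrow> cmod (A r - (- ln (1 - r)) *\<^sub>R \<mu>)"
      unfolding sums_def by (rule tendsto_norm)
    then have "cmod (A r - (- ln (1 - r)) *\<^sub>R \<mu>) \<le> B * w 0"
      by (rule Lim_bounded) (use db in auto)
    also have "\<dots> \<le> B" using B0 r by (simp add: w_def mult_left_le)
    finally have "cmod ((- ln (1 - r)) *\<^sub>R \<mu>) \<le> cmod (A r) + B"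
      using norm_triangle_ineq2 [of "(- ln (1 - r)) *\<^sub>R \<mu>" "A r"] by (simp add: norm_minus_commute)
    moreover have "ln (1 - r) \<le> 0" using r by simp
    ultimately show ?thesis by (simp add: mult.commute)
  qed
  have "filterlim (\<lambda>r::real. - ln (1 - r)) at_top (at_left 1)"
    by real_asymp
  moreover have "cmod \<mu> > 0" using nz q by (simp add: \<mu>_def)
  ultimately have "filterlim (\<lambda>r::real. cmod \<mu> * - ln (1 - r)) at_top (at_left 1)"
    using filterlim_tendsto_pos_mult_at_top [OF tendsto_const] by blast
  then have "\<forall>\<^sub>F r in at_left 1. cmod \<mu> * - ln (1 - r) > K + B"
    by (simp add: filterlim_at_top_dense)
  moreover have "\<forall>\<^sub>F r in at_left (1::real). 0 < r \<and> r < 1"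
    using eventually_at_left_real [of 0 "1::real"] by simp
  ultimately have "\<forall>\<^sub>F r in at_left (1::real). False"
    using K by eventually_elim (use bound in force)
  then show False by (simp add: trivial_limit_def [symmetric])
qed

section \<open>Quadratic Gauss sums\<close>

lemma cis_eq_1_iff: "cis (2 * pi * x) = 1 \<longleftrightarrow> x \<in> \<int>"
proof -
  have "cis (2 * pi * x) = exp (of_real (2 * pi * x) * \<i>)"
    by (simp add: cis_conv_exp mult_ac)
  then have "cis (2 * pi * x) = 1 \<longleftrightarrow> (\<exists>n::int. 2 * pi * x = of_int (2 * n) * pi)"
    by (simp add: exp_eq_1)
  also have "\<dots> \<longleftrightarrow> (\<exists>n::int. x = of_int n)" by (simp add: mult.commute)
  finally show ?thesis by (auto simp: Ints_def)
qed

lemma sum_periodic_shift: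
  fixes f :: "nat \<Rightarrow> 'a::ab_group_add"
  assumes "\<And>n. f (n + q) = f n"
  shows "(\<Sum>k<q. f (k + m)) = (\<Sum>k<q. f k)"
proof (induction m)
  case (Suc m)
  have "(\<Sum>k<q. f (k + Suc m)) + f m = (\<Sum>k<Suc q. f (k + m))"
    by (subst sum.lessThan_Suc_shift) (simp add: algebra_simps)
  also have "\<dots> = (\<Sum>k<q. f (k + m)) + f m" using assms [of m] by (simp add: add.commute)
  finally show ?case using Suc by simp
qed simp

definition gauss_term :: "int \<Rightarrow> nat \<Rightarrow> nat \<Rightarrow> complex" where
  "gauss_term a q n = cis (2 * pi * (real_of_int a * (real n)\<^sup>2 / real q))"

lemma gauss_term_periodic:
  assumes "q > 0"
  shows "gauss_term a q (n + q) = gauss_term a q n"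
proof -
  have "real_of_int a * (real (n + q))\<^sup>2 / real q
      = real_of_int a * (real n)\<^sup>2 / real q + real_of_int (a * (2 * int n + int q))"
    using assms by (simp add: field_simps power2_eq_square)
  then have "gauss_term a q (n + q)
      = gauss_term a q n * cis (2 * pi * real_of_int (a * (2 * int n + int q)))"
    by (simp only: gauss_term_def cis_mult ring_distribs)
  also have "cis (2 * pi * real_of_int (a * (2 * int n + int q))) = 1"
    by (subst cis_eq_1_iff) (rule Ints_of_int)
  finally show ?thesis by simp
qed

text \<open>
  The squared modulus of the Gauss sum \<open>G\<close> is \<open>q\<close>. With \<open>n = h + m\<close> the double sum for \<open>G\<close> times its
  conjugate becomes a sum over \<open>h\<close> of \<open>e(ah\<^sup>2/q)\<close> times the geometric sum of \<open>e(2ahm/q)\<close> over \<open>m\<close>.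
  The latter vanishes unless \<open>q\<close> divides \<open>2ah\<close>, that is, unless \<open>h = 0\<close>.
\<close>

lemma gauss_sum_nonzero:
  assumes q: "q > 0" "odd q" and a: "coprime a (int q)"
  shows "(\<Sum>n<q. gauss_term a q n) \<noteq> 0"
proof -
  let ?c = "gauss_term a q"
  let ?z = "\<lambda>h::nat. cis (2 * pi * (real_of_int (2 * a * int h) / real q))"
  define G where "G = (\<Sum>n<q. ?c n)"
  \<comment> \<open>The square of \<open>m\<close> cancels, so the dependence on \<open>m\<close> is linear in the exponent.\<close>
  have shift: "?c (h + m) * cnj (?c m) = ?c h * ?z h ^ m" for h m
  proof -
    have "real_of_int a * (real h + real m)\<^sup>2 / real q - real_of_int a * (real m)\<^sup>2 / real q
       = real_of_int a * (real h)\<^sup>2 / real q + real m * (real_of_int (2 * a * int h) / real q)"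
      using q by (simp add: field_simps power2_eq_square)
    then have "2 * pi * (real_of_int a * (real h + real m)\<^sup>2 / real q)
          + - (2 * pi * (real_of_int a * (real m)\<^sup>2 / real q))
       = 2 * pi * (real_of_int a * (real h)\<^sup>2 / real q)
          + real m * (2 * pi * (real_of_int (2 * a * int h) / real q))"
      by algebra
    then show ?thesis
      by (simp only: gauss_term_def cis_cnj Complex.DeMoivre cis_mult of_nat_add)
  qed
  have geo: "(\<Sum>m<q. ?z h ^ m) = (if h = 0 then of_nat q else 0)" if h: "h < q" for h
  proof (cases "h = 0")
    case False
    have "?z h \<noteq> 1"
    proof
      assume "?z h = 1"
      then obtain k where "real_of_int (2 * a * int h) / real q = real_of_int k"
        unfolding cis_eq_1_iff by (rule Ints_cases)
      then have "real_of_int (2 * a * int h) = real_of_int (k * int q)"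
        using q by (simp add: field_simps)
      then have "2 * a * int h = k * int q" by (simp only: of_int_eq_iff)
      then have "int q dvd 2 * a * int h" by simp
      moreover have "coprime (int q) (2 * a)"
        using q a by (simp add: coprime_commute coprime_mult_right_iff)
      ultimately have "int q dvd int h" by (simp add: coprime_dvd_mult_right_iff)
      then show False using h False by (auto dest: dvd_imp_le)
    qed
    moreover have "?z h ^ q = 1"
    proof -
      have "?z h ^ q = cis (2 * pi * real_of_int (2 * a * int h))"
        using q by (simp add: Complex.DeMoivre field_simps)
      also have "\<dots> = 1" by (subst cis_eq_1_iff) (rule Ints_of_int)
      finally show ?thesis .
    qed
    ultimately show ?thesis using False by (simp add: geometric_sum)
  qed simp
  have "G * cnj G = (\<Sum>m<q. \<Sum>h<q. ?c h * cnj (?c m))"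
    unfolding G_def cnj_sum sum_product by (rule sum.swap)
  also have "\<dots> = (\<Sum>m<q. \<Sum>h<q. ?c (h + m) * cnj (?c m))"
    using q by (intro sum.cong refl sum_periodic_shift [symmetric]) (simp add: gauss_term_periodic)
  also have "\<dots> = (\<Sum>h<q. \<Sum>m<q. ?c h * ?z h ^ m)"
    unfolding shift by (rule sum.swap)
  also have "\<dots> = (\<Sum>h<q. if h = 0 then ?c h * of_nat q else 0)"
    unfolding sum_distrib_left [symmetric]
    by (intro sum.cong refl) (auto simp only: geo lessThan_iff mult_zero_right split: if_split)
  also have "\<dots> = of_nat q" using q by (simp add: gauss_term_def)
  finally show ?thesis using q by (auto simp: G_def)
qed

section \<open>Dependence of the Abel means on the frequency\<close>

definition abel_term :: "real \<Rightarrow> real \<Rightarrow> nat \<Rightarrow> complex" where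
  "abel_term \<alpha> r k = quad_log_coeff \<alpha> (Suc k) * of_real (r ^ Suc k)"

lemma quad_log_abel_eq: "quad_log_abel \<alpha> r = (\<Sum>k. abel_term \<alpha> r k)"
  by (simp add: quad_log_abel_def abel_term_def quad_log_coeff_def)

lemma cmod_abel_term_le:
  assumes "0 \<le> r"
  shows "cmod (abel_term \<alpha> r k) \<le> r ^ Suc k"
proof -
  have "r ^ Suc k / real (Suc k) \<le> r ^ Suc k / 1"
    using assms by (intro divide_left_mono) auto
  then show ?thesis
    using assms by (simp add: abel_term_def norm_mult cmod_quad_log_coeff norm_power
        del: power_Suc of_nat_Suc)
qed

lemma summable_abel_term:
  assumes "0 \<le> r" "r < 1"
  shows "summable (abel_term \<alpha> r)"
proof (rule summable_comparison_test)
  show "\<exists>N. \<forall>n\<ge>N. norm (abel_term \<alpha> r n) \<le> r ^ Suc n"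
    using cmod_abel_term_le assms by blast
qed (use assms in \<open>simp add: summable_geometric summable_mult\<close>)

lemma continuous_quad_log_abel:
  assumes "0 \<le> r" "r < 1"
  shows "continuous_on UNIV (\<lambda>\<alpha>. quad_log_abel \<alpha> r)"
proof -
  have summable_power_Suc: "summable (\<lambda>k. r ^ Suc k)"
    using assms by (simp add: summable_geometric summable_mult)
  show ?thesis unfolding quad_log_abel_eq
  proof (rule uniform_limit_theorem)
    show "uniform_limit UNIV (\<lambda>n \<alpha>. \<Sum>k<n. abel_term \<alpha> r k) (\<lambda>\<alpha>. \<Sum>k. abel_term \<alpha> r k) sequentially"
      using assms cmod_abel_term_le
      by (intro Weierstrass_m_test [where M = "\<lambda>k. r ^ Suc k"]) (auto simp: summable_power_Suc simp del: power_Suc)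
    show "\<forall>\<^sub>F n in sequentially. continuous_on UNIV (\<lambda>\<alpha>. \<Sum>k<n. abel_term \<alpha> r k)"
      unfolding abel_term_def quad_log_coeff_def
      by (intro always_eventually allI continuous_intros) (simp del: of_nat_Suc)
  qed simp
qed

lemma quad_log_abel_rational_unbounded:
  assumes q: "q > 0" "odd q" and a: "coprime a (int q)"
  shows "\<not> Bfun (quad_log_abel (real_of_int a / real q)) (at_left 1)"
proof -
  have c: "exp (2 * complex_of_real pi * \<i> * complex_of_real (real_of_int a / real q * (real n)\<^sup>2))
      = gauss_term a q n" for n
    by (simp add: gauss_term_def cis_conv_exp mult_ac)
  have "\<not> Bfun (\<lambda>r::real. \<Sum>k. gauss_term a q (Suc k) / of_nat (Suc k) * of_real (r ^ Suc k)) (at_left 1)"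
  proof (rule abel_mean_periodic_unbounded [OF q(1)])
    show "gauss_term a q (Suc (n + q)) = gauss_term a q (Suc n)" for n
      using gauss_term_periodic [OF q(1), of a "Suc n"] by simp
    have "(\<Sum>k<q. gauss_term a q (k + 1)) = (\<Sum>k<q. gauss_term a q k)"
      by (intro sum_periodic_shift gauss_term_periodic q)
    then show "(\<Sum>k<q. gauss_term a q (Suc k)) \<noteq> 0"
      using gauss_sum_nonzero [OF assms] by simp
  qed
  then show ?thesis unfolding quad_log_abel_def [abs_def] c .
qed

text \<open>
  Powers of \<open>3\<close> serve as denominators: they are odd, and among two consecutive numerators at least
  one is coprime to them.
\<close>

lemma exists_coprime_fraction_near:
  fixes x e :: real
  assumes "e > 0"
  obtains a :: int and q :: nat where "q > 0" "odd q" "coprime a (int q)"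
    "\<bar>real_of_int a / real q - x\<bar> < e"
proof -
  obtain k :: nat where k: "2 / e < 3 ^ k"
    using real_arch_pow [of 3 "2 / e"] by auto
  define q :: nat where "q = 3 ^ k"
  define b where "b = \<lfloor>x * real q\<rfloor>"
  define a where "a = (if 3 dvd b then b + 1 else b)"
  have q: "real q > 2 / e" "q > 0" "odd q" using k by (auto simp: q_def)
  have "\<not> 3 dvd a" unfolding a_def by presburger
  then have "coprime a 3"
    using prime_imp_coprime [of "3::int" a] by (simp add: coprime_commute)
  then have cop: "coprime a (int q)" by (simp add: q_def)
  have "\<bar>real_of_int a - x * real q\<bar> < 2" unfolding a_def b_def by (auto; linarith)
  moreover have "2 < e * real q" using q assms by (simp add: field_simps)
  moreover have "real_of_int a / real q - x = (real_of_int a - x * real q) / real q"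
    using q by (simp add: field_simps)
  ultimately have "\<bar>real_of_int a / real q - x\<bar> < e"
    using q by (simp add: abs_divide divide_simps)
  with q cop show ?thesis using that by blast
qed

text \<open>
  Baire's theorem is applied to sets \<open>U M\<close> in which the radius is confined to an interval shrinking
  to \<open>1\<close>: a point in all of them then has unbounded Abel means near \<open>1\<close> and not only somewhere in
  \<open>(0, 1)\<close>.
\<close>

lemma exists_irrational_unbounded_abel:
  "\<exists>\<alpha>. \<alpha> \<notin> \<rat> \<and> \<not> Bfun (quad_log_abel \<alpha>) (at_left 1)"
proof -
  define U where "U M = (\<Union>r\<in>{1 - 1 / real (Suc M)<..<1}. {\<alpha>. cmod (quad_log_abel \<alpha> r) > real M})" for M
  have rng: "0 \<le> r" if "r \<in> {1 - 1 / real (Suc M)<..<1}" for r M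
  proof -
    have "1 / real (Suc M) \<le> 1" by simp
    then show ?thesis using that unfolding greaterThanLessThan_iff by linarith
  qed
  have "open (U M)" for M
    unfolding U_def
  proof (intro open_UN ballI)
    fix r assume r: "r \<in> {1 - 1 / real (Suc M)<..<1}"
    then have "continuous_on UNIV (\<lambda>\<alpha>. quad_log_abel \<alpha> r)"
      using rng by (intro continuous_quad_log_abel) auto
    then show "open {\<alpha>. cmod (quad_log_abel \<alpha> r) > real M}"
      by (intro open_Collect_less continuous_intros)
  qed
  moreover have "closure (U M) = UNIV" for M
  proof -
    have "x \<in> closure (U M)" for x
      unfolding closure_approachable
    proof (intro allI impI)
      fix e :: real assume "e > 0"
      then obtain a q where q: "q > 0" "odd q" "coprime a (int q)" "\<bar>real_of_int a / real q - x\<bar> < e"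
        by (rule exists_coprime_fraction_near)
      define \<alpha> where "\<alpha> = real_of_int a / real q"
      have "\<not> Bfun (quad_log_abel \<alpha>) (at_left 1)"
        unfolding \<alpha>_def using q by (intro quad_log_abel_rational_unbounded)
      then have "\<not> (\<forall>\<^sub>F r in at_left 1. cmod (quad_log_abel \<alpha> r) \<le> real M)"
        using BfunI by blast
      moreover have "\<forall>\<^sub>F r in at_left 1. r \<in> {1 - 1 / real (Suc M)<..<1}"
        by (intro eventually_at_left_real) simp
      ultimately have "\<exists>r\<in>{1 - 1 / real (Suc M)<..<1}. cmod (quad_log_abel \<alpha> r) > real M"
        by (smt (verit, best) eventually_mono)
      then have "\<alpha> \<in> U M" by (auto simp: U_def)
      then show "\<exists>y\<in>U M. dist y x < e" using q by (auto simp: \<alpha>_def dist_real_def)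
    qed
    then show ?thesis by auto
  qed
  ultimately have U: "T \<in> range U \<Longrightarrow> open T \<and> closure T = UNIV" for T by auto
  have pts: "T \<in> (\<lambda>x. - {x}) ` \<rat> \<Longrightarrow> open T \<and> closure T = UNIV" for T :: "real set"
    by (auto simp: closure_complement interior_singleton)
  have "UNIV \<subseteq> closure (\<Inter>(range U \<union> (\<lambda>x. - {x}) ` \<rat>))"
    by (rule Baire) (use U pts in \<open>auto simp: countable_rat\<close>)
  then have "\<Inter>(range U \<union> (\<lambda>x. - {x}) ` \<rat>) \<noteq> {}" by (metis UNIV_not_empty closure_empty subset_empty)
  then obtain \<alpha> where \<alpha>: "\<And>M. \<alpha> \<in> U M" "\<alpha> \<notin> \<rat>" by blast
  have "\<not> Bfun (quad_log_abel \<alpha>) (at_left 1)"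
  proof
    assume "Bfun (quad_log_abel \<alpha>) (at_left 1)"
    then obtain K where "\<forall>\<^sub>F r in at_left 1. cmod (quad_log_abel \<alpha> r) \<le> K"
      unfolding Bfun_def by blast
    then obtain b where b: "b < 1" "\<And>r. b < r \<Longrightarrow> r < 1 \<Longrightarrow> cmod (quad_log_abel \<alpha> r) \<le> K"
      by (auto simp: eventually_at_left_field)
    obtain M1 :: nat where M1: "K < real M1" using reals_Archimedean2 by blast
    obtain M2 :: nat where M2: "1 / real (Suc M2) < 1 - b"
      using b(1) nat_approx_posE [of "1 - b"] by (auto simp: field_simps)
    define M where "M = max M1 M2"
    have "1 / real (Suc M) \<le> 1 / real (Suc M2)" by (intro divide_left_mono) (auto simp: M_def)
    moreover obtain r where "1 - 1 / real (Suc M) < r" "r < 1" "cmod (quad_log_abel \<alpha> r) > real M"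
      using \<alpha>(1) [of M] by (auto simp: U_def)
    ultimately show False using b(2) [of r] M1 M2 by (auto simp: M_def)
  qed
  with \<alpha>(2) show ?thesis by blast
qed

section \<open>Continuous representatives have bounded Abel means\<close>

text \<open>
  Convergence in \<open>L\<^sup>2\<close> implies weak convergence. In place of the Cauchy-Schwarz inequality the proof
  uses \<open>ab \<le> \<delta>b\<^sup>2 + a\<^sup>2/\<delta>\<close> with \<open>\<delta>\<close> chosen at the end.
\<close>

lemma quad_log_partial_weak_limit:
  assumes g: "g \<in> quad_log_series \<alpha>" "continuous_on UNIV g" and Q: "continuous_on UNIV Q"
  shows "(\<lambda>N. integral {0..1} (\<lambda>x. quad_log_partial \<alpha> N x * Q x)) \<longlonglongrightarrow> integral {0..1} (\<lambda>x. g x * Q x)"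
proof -
  define D where "D N x = quad_log_partial \<alpha> N x - g x" for N x
  define I where "I N = integral {0..1} (\<lambda>x. (cmod (D N x))\<^sup>2)" for N
  define A where "A = integral {0..1} (\<lambda>x. (cmod (Q x))\<^sup>2)"
  have Dc: "continuous_on S (D N)" for N S
    unfolding D_def by (intro continuous_intros continuous_quad_log_partial continuous_on_subset [OF g(2)]) auto
  have gc: "continuous_on S g" and Qc: "continuous_on S Q" for S
    using g(2) Q continuous_on_subset by blast+
  have I: "I \<longlonglongrightarrow> 0"
  proof -
    have "(LINT x:{0..1}|lebesgue. (cmod (D N x))\<^sup>2) = I N" for N
      unfolding I_def
      by (intro set_lebesgue_integral_eq_integral absolutely_integrable_continuous_real continuous_intros Dc)
    then show ?thesis using g(1) by (simp add: quad_log_series_def D_def)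
  qed
  have A: "A \<ge> 0" unfolding A_def
    by (intro integral_nonneg integrable_continuous_real continuous_intros Qc) auto
  have main: "cmod (integral {0..1} (\<lambda>x. quad_log_partial \<alpha> N x * Q x) - integral {0..1} (\<lambda>x. g x * Q x))
     \<le> \<delta> * A + I N / \<delta>" if \<delta>: "\<delta> > 0" for \<delta> N
  proof -
    have pt: "cmod (D N x * Q x) \<le> \<delta> * (cmod (Q x))\<^sup>2 + (cmod (D N x))\<^sup>2 / \<delta>" for x
    proof -
      define a b where "a = cmod (D N x)" and "b = cmod (Q x)"
      have "2 * (\<delta> * b) * a \<le> (\<delta> * b)\<^sup>2 + a\<^sup>2" by (rule sum_squares_bound)
      moreover have "0 \<le> a * (\<delta> * b)" using \<delta> by (simp add: a_def b_def)
      ultimately have "a * b * \<delta> \<le> (\<delta> * b)\<^sup>2 + a\<^sup>2" by (simp add: mult_ac)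
      then have "a * b \<le> \<delta> * b\<^sup>2 + a\<^sup>2 / \<delta>" using \<delta> by (simp add: field_simps power2_eq_square)
      then show ?thesis by (simp add: a_def b_def norm_mult)
    qed
    have "integral {0..1} (\<lambda>x. quad_log_partial \<alpha> N x * Q x) - integral {0..1} (\<lambda>x. g x * Q x)
        = integral {0..1} (\<lambda>x. D N x * Q x)"
      unfolding D_def left_diff_distrib
      by (intro Henstock_Kurzweil_Integration.integral_diff [symmetric] integrable_continuous_real continuous_intros
          continuous_quad_log_partial gc Qc)
    also have "cmod \<dots> \<le> integral {0..1} (\<lambda>x. \<delta> * (cmod (Q x))\<^sup>2 + (cmod (D N x))\<^sup>2 / \<delta>)"
      using \<delta> by (intro integral_norm_bound_integral pt integrable_continuous_real continuous_intros Dc Qc) auto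
    also have "\<dots> = \<delta> * A + I N / \<delta>"
      unfolding A_def I_def using \<delta>
      by (subst Henstock_Kurzweil_Integration.integral_add)
         (auto intro!: integrable_continuous_real continuous_intros Dc Qc)
    finally show ?thesis .
  qed
  show ?thesis
  proof (rule LIMSEQ_I)
    fix e :: real assume e: "e > 0"
    define \<delta> where "\<delta> = e / (2 * (A + 1))"
    have \<delta>: "\<delta> > 0" using e A by (simp add: \<delta>_def)
    have dA: "\<delta> * A < e / 2"
    proof -
      have "\<delta> * A < \<delta> * (A + 1)" using \<delta> by simp
      also have "\<dots> = e / 2" using A by (simp add: \<delta>_def field_simps)
      finally show ?thesis .
    qed
    have "\<forall>\<^sub>F N in sequentially. I N < \<delta> * (e / 2)"
      using I \<delta> e by (intro order_tendstoD(2)) auto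
    then obtain n0 where n0: "\<And>N. N \<ge> n0 \<Longrightarrow> I N < \<delta> * (e / 2)"
      by (auto simp: eventually_sequentially)
    show "\<exists>no. \<forall>N\<ge>no. norm (integral {0..1} (\<lambda>x. quad_log_partial \<alpha> N x * Q x) - integral {0..1} (\<lambda>x. g x * Q x)) < e"
    proof (intro exI [of _ n0] allI impI)
      fix N assume "N \<ge> n0"
      then have "I N / \<delta> < e / 2" using n0 \<delta> by (simp add: field_simps)
      then show "norm (integral {0..1} (\<lambda>x. quad_log_partial \<alpha> N x * Q x) - integral {0..1} (\<lambda>x. g x * Q x)) < e"
        using main [OF \<delta>, of N] dA by linarith
    qed
  qed
qed

text \<open>
  As \<open>K \<rightarrow> \<infinity>\<close> this tends to \<open>1/(1 - r e(x))\<close>, so \<open>1 - r\<^sup>2\<close> times its squared modulus tends to the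
  Poisson kernel. The squared modulus is a nonnegative trigonometric polynomial for every \<open>K\<close>.
\<close>

definition poisson_sum :: "real \<Rightarrow> nat \<Rightarrow> real \<Rightarrow> complex" where
  "poisson_sum r K x = (\<Sum>j<K. of_real (r ^ j) * cis (2 * pi * real j * x))"

lemma continuous_poisson_sum: "continuous_on S (poisson_sum r K)"
  unfolding poisson_sum_def by (intro continuous_intros)

lemma poisson_sum_square:
  "complex_of_real ((cmod (poisson_sum r K x))\<^sup>2)
    = (\<Sum>j<K. \<Sum>k<K. of_real (r ^ (j + k)) * cis (2 * pi * real_of_int (int j - int k) * x))"
proof -
  have "complex_of_real ((cmod (poisson_sum r K x))\<^sup>2) = poisson_sum r K x * cnj (poisson_sum r K x)"
    by (rule complex_norm_square)
  also have "\<dots> = (\<Sum>j<K. \<Sum>k<K. (of_real (r ^ j) * cis (2 * pi * real j * x))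
      * (of_real (r ^ k) * cis (- (2 * pi * real k * x))))"
    by (simp add: poisson_sum_def sum_product cis_cnj)
  also have "\<dots> = (\<Sum>j<K. \<Sum>k<K. of_real (r ^ (j + k)) * cis (2 * pi * real_of_int (int j - int k) * x))"
  proof (intro sum.cong refl)
    fix j k
    have "cis (2 * pi * real j * x) * cis (- (2 * pi * real k * x)) = cis (2 * pi * real_of_int (int j - int k) * x)"
      by (simp add: cis_mult algebra_simps)
    then show "(of_real (r ^ j) * cis (2 * pi * real j * x)) * (of_real (r ^ k) * cis (- (2 * pi * real k * x)))
      = of_real (r ^ (j + k)) * cis (2 * pi * real_of_int (int j - int k) * x)"
      by (metis (no_types, opaque_lifting) mult.assoc mult.left_commute of_real_mult power_add)
  qed
  finally show ?thesis .
qed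

text \<open>
  Orthogonality keeps the pairs with \<open>k = n + j < K\<close>, each of weight \<open>r\<^bsup>j + k\<^esup> = r\<^bsup>n + 2j\<^esup>\<close>.
  For \<open>n \<ge> K\<close> the truncated difference \<open>K - n\<close> makes the sum empty, as it should be.
\<close>

lemma has_integral_poisson_sum_square_mult_cis:
  "((\<lambda>x. cis (2 * pi * real n * x) * complex_of_real ((cmod (poisson_sum r K x))\<^sup>2))
     has_integral of_real (r ^ n * (\<Sum>j<K - n. (r\<^sup>2) ^ j))) {0..1}"
proof -
  have eq: "cis (2 * pi * real n * x) * complex_of_real ((cmod (poisson_sum r K x))\<^sup>2)
     = (\<Sum>j<K. \<Sum>k<K. of_real (r ^ (j + k)) * cis (2 * pi * real_of_int (int n + int j - int k) * x))" for x
  proof -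
    have "cis (2 * pi * real n * x) * cis (2 * pi * real_of_int (int j - int k) * x)
       = cis (2 * pi * real_of_int (int n + int j - int k) * x)" for j k
      by (simp add: cis_mult algebra_simps)
    then show ?thesis unfolding poisson_sum_square sum_distrib_left
      by (intro sum.cong refl) (metis mult.left_commute)
  qed
  have val: "(\<Sum>j<K. \<Sum>k<K. of_real (r ^ (j + k)) * (if int n + int j - int k = 0 then 1 else 0))
     = complex_of_real (r ^ n * (\<Sum>j<K - n. (r\<^sup>2) ^ j))"
  proof -
    have "(\<Sum>k<K. complex_of_real (r ^ (j + k)) * (if int n + int j - int k = 0 then 1 else 0))
       = (if n + j < K then of_real (r ^ n * (r\<^sup>2) ^ j) else 0)" for j
    proof -
      have "(\<Sum>k<K. complex_of_real (r ^ (j + k)) * (if int n + int j - int k = 0 then 1 else 0))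
         = (\<Sum>k<K. if n + j = k then of_real (r ^ (j + k)) else 0)"
        by (intro sum.cong) auto
      also have "\<dots> = (if n + j < K then of_real (r ^ (j + (n + j))) else 0)" by simp
      also have "r ^ (j + (n + j)) = r ^ n * (r\<^sup>2) ^ j"
        by (simp add: power_add power_mult [symmetric] mult_2)
      finally show ?thesis .
    qed
    then have "(\<Sum>j<K. \<Sum>k<K. of_real (r ^ (j + k)) * (if int n + int j - int k = 0 then 1 else 0))
       = (\<Sum>j<K. if n + j < K then complex_of_real (r ^ n * (r\<^sup>2) ^ j) else 0)" by simp
    also have "\<dots> = (\<Sum>j<K - n. complex_of_real (r ^ n * (r\<^sup>2) ^ j))"
      by (rule sum.mono_neutral_cong_right) auto
    finally show ?thesis by (simp add: sum_distrib_left)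
  qed
  show ?thesis
    unfolding eq val [symmetric]
    by (intro has_integral_sum has_integral_mult_right has_integral_cis_int) auto
qed

text \<open>
  Integrating \<open>g\<close> against the kernel \<open>(1 - r\<^sup>2) \<bar>\<Sum>\<^sub>j\<^sub><\<^sub>K r\<^sup>j e(jx)\<bar>\<^sup>2\<close>, whose integral is at most \<open>1\<close>,
  gives a number of modulus at most \<open>C\<close>. By weak convergence this number is the sum of the
  coefficients weighted by \<open>r\<^sup>n (1 - r\<^bsup>2(K - n)\<^esup>)\<close>. The \<open>K\<close> correction terms have weights
  \<open>r\<^bsup>n + 2(K - n)\<^esup> \<le> r\<^sup>K\<close> and coefficients of modulus at most \<open>1\<close>.
\<close>

lemma truncated_abel_mean_bound:
  assumes g: "g \<in> quad_log_series \<alpha>" "continuous_on UNIV g"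
    and C: "\<And>x. x \<in> {0..1} \<Longrightarrow> cmod (g x) \<le> C" and r: "0 < r" "r < 1"
  shows "cmod (\<Sum>n=1..K. quad_log_coeff \<alpha> n * of_real (r ^ n)) \<le> C + real K * r ^ K"
proof -
  define Q where "Q x = complex_of_real ((cmod (poisson_sum r K x))\<^sup>2)" for x
  define V where "V = (\<Sum>n=1..K. quad_log_coeff \<alpha> n * of_real (r ^ n * (\<Sum>j<K - n. (r\<^sup>2) ^ j)))"
  have r2: "0 < r\<^sup>2" "r\<^sup>2 < 1" using r by (auto simp: power_less_one_iff)
  have C0: "0 \<le> C" using C [of 0] norm_ge_zero [of "g 0"] by (simp del: norm_ge_zero)
  have Qc: "continuous_on S Q" for S
    unfolding Q_def by (intro continuous_intros continuous_poisson_sum)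
  \<comment> \<open>The kernel has degree below \<open>K\<close>, so it does not see the frequencies beyond \<open>K\<close>.\<close>
  have coeff: "integral {0..1} (\<lambda>x. quad_log_partial \<alpha> N x * Q x) = V" if N: "N \<ge> K" for N
  proof -
    have "((\<lambda>x. \<Sum>n=1..N. quad_log_coeff \<alpha> n * (cis (2 * pi * real n * x) * Q x)) has_integral
        (\<Sum>n=1..N. quad_log_coeff \<alpha> n * of_real (r ^ n * (\<Sum>j<K - n. (r\<^sup>2) ^ j)))) {0..1}"
      unfolding Q_def
      by (intro has_integral_sum has_integral_mult_right has_integral_poisson_sum_square_mult_cis) auto
    moreover have "(\<Sum>n=1..N. quad_log_coeff \<alpha> n * of_real (r ^ n * (\<Sum>j<K - n. (r\<^sup>2) ^ j))) = V"
      unfolding V_def using N by (intro sum.mono_neutral_right) auto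
    ultimately show ?thesis
      by (simp add: quad_log_partial_eq sum_distrib_right mult.assoc integral_unique)
  qed
  have "(\<lambda>N. integral {0..1} (\<lambda>x. quad_log_partial \<alpha> N x * Q x)) \<longlonglongrightarrow> V"
    using coeff by (intro tendsto_eventually) (auto simp: eventually_sequentially)
  then have V: "integral {0..1} (\<lambda>x. g x * Q x) = V"
    using quad_log_partial_weak_limit [OF g Qc] LIMSEQ_unique by blast
  have "((\<lambda>x. Re (cis (2 * pi * real 0 * x) * Q x)) has_integral
      Re (of_real (r ^ 0 * (\<Sum>j<K - 0. (r\<^sup>2) ^ j)))) {0..1}"
    using has_integral_linear [OF has_integral_poisson_sum_square_mult_cis bounded_linear_Re]
    unfolding Q_def o_def .
  then have Q1: "integral {0..1} (\<lambda>x. Re (Q x)) = (\<Sum>j<K. (r\<^sup>2) ^ j)"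
    by (simp add: integral_unique)
  have "cmod V \<le> integral {0..1} (\<lambda>x. C * Re (Q x))"
    unfolding V [symmetric]
  proof (rule integral_norm_bound_integral)
    show "(\<lambda>x. g x * Q x) integrable_on {0..1}"
      by (intro integrable_continuous_real continuous_intros Qc continuous_on_subset [OF g(2)]) auto
    show "(\<lambda>x. C * Re (Q x)) integrable_on {0..1}"
      by (intro integrable_continuous_real continuous_intros Qc)
    show "cmod (g x * Q x) \<le> C * Re (Q x)" if "x \<in> {0..1}" for x
      using C [OF that] unfolding Q_def norm_mult norm_of_real Re_complex_of_real
      by (simp add: mult_right_mono)
  qed
  also have "\<dots> = C * (\<Sum>j<K. (r\<^sup>2) ^ j)" by (simp add: Q1)
  also have "\<dots> \<le> C * (1 / (1 - r\<^sup>2))"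
    by (rule mult_left_mono [OF less_imp_le [OF geometric_sum_less]]) (use C0 r2 in auto)
  finally have Vb: "cmod V * (1 - r\<^sup>2) \<le> C" using r2 by (simp add: field_simps)
  define W where "W = (\<Sum>n=1..K. quad_log_coeff \<alpha> n * of_real (r ^ n * (r\<^sup>2) ^ (K - n)))"
  have "V * of_real (1 - r\<^sup>2) = (\<Sum>n=1..K. quad_log_coeff \<alpha> n * of_real (r ^ n)) - W"
    unfolding V_def W_def sum_distrib_right sum_subtractf [symmetric]
  proof (intro sum.cong refl)
    fix n
    have "(\<Sum>j<K - n. (r\<^sup>2) ^ j) * (1 - r\<^sup>2) = 1 - (r\<^sup>2) ^ (K - n)"
      using r2 by (simp add: sum_gp_strict)
    then have "r ^ n * (\<Sum>j<K - n. (r\<^sup>2) ^ j) * (1 - r\<^sup>2) = r ^ n - r ^ n * (r\<^sup>2) ^ (K - n)"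
      by (metis mult.assoc mult.right_neutral right_diff_distrib)
    then show "quad_log_coeff \<alpha> n * of_real (r ^ n * (\<Sum>j<K - n. (r\<^sup>2) ^ j)) * of_real (1 - r\<^sup>2)
       = quad_log_coeff \<alpha> n * of_real (r ^ n) - quad_log_coeff \<alpha> n * of_real (r ^ n * (r\<^sup>2) ^ (K - n))"
      by (metis mult.assoc of_real_diff of_real_mult right_diff_distrib)
  qed
  then have "(\<Sum>n=1..K. quad_log_coeff \<alpha> n * of_real (r ^ n)) = V * of_real (1 - r\<^sup>2) + W" by simp
  then have "cmod (\<Sum>n=1..K. quad_log_coeff \<alpha> n * of_real (r ^ n)) \<le> cmod (V * of_real (1 - r\<^sup>2)) + cmod W"
    by (simp only: norm_triangle_ineq)
  also have "cmod (V * of_real (1 - r\<^sup>2)) \<le> C"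
    using Vb r2 by (simp only: norm_mult norm_of_real)
  also have "cmod W \<le> (\<Sum>n=1..K. r ^ K)"
    unfolding W_def
  proof (rule sum_norm_le)
    fix n assume n: "n \<in> {1..K}"
    have "r ^ n * (r\<^sup>2) ^ (K - n) = r ^ (n + 2 * (K - n))" by (simp add: power_add power_mult)
    also have "\<dots> \<le> r ^ K" using r n by (intro power_decreasing) auto
    finally have "r ^ n * (r\<^sup>2) ^ (K - n) \<le> r ^ K" .
    moreover have "0 \<le> r ^ n * (r\<^sup>2) ^ (K - n)" using r by simp
    moreover have "1 / real n \<le> 1" using n by simp
    ultimately have "(1 / real n) * (r ^ n * (r\<^sup>2) ^ (K - n)) \<le> 1 * r ^ K"
      by (intro mult_mono) auto
    then show "cmod (quad_log_coeff \<alpha> n * of_real (r ^ n * (r\<^sup>2) ^ (K - n))) \<le> r ^ K"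
      using \<open>0 \<le> r ^ n * (r\<^sup>2) ^ (K - n)\<close>
      by (simp only: norm_mult [of "quad_log_coeff \<alpha> n"] norm_of_real cmod_quad_log_coeff abs_of_nonneg)
  qed
  finally show ?thesis by simp
qed

lemma continuous_representative_imp_Bfun_abel:
  assumes g: "g \<in> quad_log_series \<alpha>" "continuous_on UNIV g"
  shows "Bfun (quad_log_abel \<alpha>) (at_left 1)"
proof -
  have "compact (g ` {0..1})"
    by (intro compact_continuous_image continuous_on_subset [OF g(2)]) auto
  then obtain C where C: "\<And>x. x \<in> {0..1} \<Longrightarrow> cmod (g x) \<le> C"
    using compact_imp_bounded bounded_iff by (metis imageI)
  have bd: "cmod (quad_log_abel \<alpha> r) \<le> C" if r: "0 < r" "r < 1" for r
  proof -
    have part: "(\<Sum>k<K. abel_term \<alpha> r k) = (\<Sum>n=1..K. quad_log_coeff \<alpha> n * of_real (r ^ n))" for K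
      unfolding abel_term_def by (rule sum.reindex_bij_witness [of _ "\<lambda>n. n - 1" Suc]) auto
    have "(\<lambda>K. cmod (\<Sum>k<K. abel_term \<alpha> r k)) \<longlonglongrightarrow> cmod (quad_log_abel \<alpha> r)"
      unfolding quad_log_abel_eq
      using r by (intro tendsto_norm summable_LIMSEQ summable_abel_term) auto
    moreover have "(\<lambda>K. C + real K * r ^ K) \<longlonglongrightarrow> C + 0"
      using r by (intro tendsto_intros powser_times_n_limit_0) auto
    ultimately show ?thesis
      using truncated_abel_mean_bound [OF g C r]
      by (intro LIMSEQ_le [of _ _ "\<lambda>K. C + real K * r ^ K"]) (auto simp: part)
  qed
  have "\<forall>\<^sub>F r in at_left (1::real). 0 < r \<and> r < 1"
    using eventually_at_left_real [of 0 "1::real"] by simp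
  then have "\<forall>\<^sub>F r in at_left 1. cmod (quad_log_abel \<alpha> r) \<le> C"
    by eventually_elim (use bd in auto)
  then show ?thesis by (rule BfunI)
qed

theorem proposition1p8:
  shows "\<exists>\<alpha>::real. \<alpha> \<notin> \<rat> \<and>
           \<not> Bfun (quad_log_abel \<alpha>) (at_left 1) \<and>
           \<not> (\<exists>g \<in> quad_log_series \<alpha>. continuous_on UNIV g)"
  using exists_irrational_unbounded_abel continuous_representative_imp_Bfun_abel by blast

end
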